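(* Let $\Lambda=kQ/I$ be a bound quiver algebra with a squared-zero loop $l:i\to i$, and let $\alpha$ be an arrow of $Q$ with target $t(\alpha)=i$. If $\alpha l\in I$, then $\alpha$ is not eventually removable in $\Lambda$. In particular, a squared-zero loop is never eventually removable.
   Context: A bound quiver algebra $\Lambda=kQ/I$ consists of a field $k$, a finite quiver $Q$ and an admissible ideal $I$ of the path algebra $kQ$ (every path occurring in an element of $I$ has length at least $2$, and $I$ contains all paths of length $N$ for some $N>1$). Paths are composed from left to right. A squared-zero loop is an arrow $l:i\to i$ with $l^2\in I$. For a set $A$ of arrows (possibly empty), $\langle A+I\rangle$ is the ideal of $\Lambda$ generated by the cosets of the arrows in $A$. Every $z\in kQ$ is uniquely $z=z_A+z_{\mathrm{not}A}$, where $z_A$ is a linear combination of paths passing through at least one arrow of $A$ and $z_{\mathrm{not}A}$ one of paths avoiding $A$. $A$ is pre-removable in $\Lambda$ if $z_A,z_{\mathrm{not}A}\in I$ for every $z\in I$. A pre-removable set $A$ is two-sided removable if $\langle A+I\rangle$ has finite projective dimension both as a left and as a right $\Lambda$-module; only left removable if $\langle A+I\rangle^2=0$ and $\langle A+I\rangle$ has finite projective dimension as a right but not as a left $\Lambda$-module; removable if two-sided or only left removable. If $A$ is pre-removable, the canonical representation of $\Lambda/\langle A+I\rangle$ is the bound quiver algebra $kQ'/I'$, where $Q'$ is $Q$ with the arrows of $A$ deleted and $I'$ is the set of elements of $I$ that are linear combinations of paths avoiding $A$; $B\subseteq Q_1\setminus A$ is called removable in $\Lambda/\langle A+I\rangle$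 if it is removable in $kQ'/I'$. A set $A$ is eventually removable in $\Lambda$ if there is an ordered partition $A=A_1\dot\cup\cdots\dot\cup A_m$ such that $A_r$ is removable in $\Lambda/\langle(A_1\dot\cup\cdots\dot\cup A_{r-1})+I\rangle$ for every $r$ (the sets $A_1\dot\cup\cdots\dot\cup A_{r-1}$ are then automatically pre-removable). There is a unique maximal eventually removable set of arrows, and an arrow is eventually removable in $\Lambda$ if it belongs to this set. *)

theory Defs
  imports
    "HOL-Library.Poly_Mapping"
    "HOL-Algebra.Module"
    "HOL-Algebra.QuotRing"
    "HOL-Algebra.Ideal_Product"
    "Graph_Theory.Arc_Walk"
begin

section \<open>Modules over noncommutative rings\<close>

text \<open>
  The locale \<open>module\<close> of HOL-Algebra requires a commutative ring; the following
  locale has the same axioms over an arbitrary ring with one. As in HOL-Algebra, the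
  multiplicative fields of the module record play no role.
\<close>

locale lmodule = R?: ring R + M?: abelian_group M
  for R :: "('r, 'x) ring_scheme" (structure)
  and M :: "('r, 'm, 'y) module_scheme" (structure) +
  assumes smult_closed:
      "\<lbrakk>a \<in> carrier R; x \<in> carrier M\<rbrakk> \<Longrightarrow> a \<odot>\<^bsub>M\<^esub> x \<in> carrier M"
    and smult_l_distr:
      "\<lbrakk>a \<in> carrier R; b \<in> carrier R; x \<in> carrier M\<rbrakk> \<Longrightarrow>
        (a \<oplus>\<^bsub>R\<^esub> b) \<odot>\<^bsub>M\<^esub> x = a \<odot>\<^bsub>M\<^esub> x \<oplus>\<^bsub>M\<^esub> b \<odot>\<^bsub>M\<^esub> x"
    and smult_r_distr:
      "\<lbrakk>a \<in> carrier R; x \<in> carrier M; y \<in> carrier M\<rbrakk> \<Longrightarrow>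
        a \<odot>\<^bsub>M\<^esub> (x \<oplus>\<^bsub>M\<^esub> y) = a \<odot>\<^bsub>M\<^esub> x \<oplus>\<^bsub>M\<^esub> a \<odot>\<^bsub>M\<^esub> y"
    and smult_assoc1:
      "\<lbrakk>a \<in> carrier R; b \<in> carrier R; x \<in> carrier M\<rbrakk> \<Longrightarrow>
        (a \<otimes>\<^bsub>R\<^esub> b) \<odot>\<^bsub>M\<^esub> x = a \<odot>\<^bsub>M\<^esub> (b \<odot>\<^bsub>M\<^esub> x)"
    and smult_one:
      "x \<in> carrier M \<Longrightarrow> \<one>\<^bsub>R\<^esub> \<odot>\<^bsub>M\<^esub> x = x"

text \<open>Right modules over \<open>R\<close> are left modules over \<open>opposite_ring R\<close>.\<close>

definition opposite_ring :: "('r, 'x) ring_scheme \<Rightarrow> ('r, 'x) ring_scheme" where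
  "opposite_ring R = R\<lparr>mult := (\<lambda>a b. b \<otimes>\<^bsub>R\<^esub> a)\<rparr>"

definition lmod_hom ::
    "('r, 'x) ring_scheme \<Rightarrow> ('r, 'm, 'y) module_scheme \<Rightarrow> ('r, 'n, 'z) module_scheme \<Rightarrow> ('m \<Rightarrow> 'n) set"
  where
  "lmod_hom R M N =
    {f \<in> carrier M \<rightarrow> carrier N.
      (\<forall>x\<in>carrier M. \<forall>y\<in>carrier M. f (x \<oplus>\<^bsub>M\<^esub> y) = f x \<oplus>\<^bsub>N\<^esub> f y) \<and>
      (\<forall>a\<in>carrier R. \<forall>x\<in>carrier M. f (a \<odot>\<^bsub>M\<^esub> x) = a \<odot>\<^bsub>N\<^esub> f x)}"

text \<open>The free left module \<open>R\<^sup>(\<^sup>X\<^sup>)\<close>: finitely supported functions on \<open>X\<close>, set to zero outside \<open>X\<close>.\<close>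

definition free_lmodule :: "('r, 'x) ring_scheme \<Rightarrow> 'i set \<Rightarrow> ('r, 'i \<Rightarrow> 'r) module" where
  "free_lmodule R X =
    \<lparr>carrier = {f. (\<forall>i\<in>X. f i \<in> carrier R) \<and> (\<forall>i. i \<notin> X \<longrightarrow> f i = \<zero>\<^bsub>R\<^esub>) \<and> finite {i. f i \<noteq> \<zero>\<^bsub>R\<^esub>}},
     mult = (\<lambda>f g. undefined), one = undefined,
     zero = (\<lambda>_. \<zero>\<^bsub>R\<^esub>), add = (\<lambda>f g i. f i \<oplus>\<^bsub>R\<^esub> g i),
     smult = (\<lambda>a f i. a \<otimes>\<^bsub>R\<^esub> f i)\<rparr>"

text \<open>
  Projective modules are the direct summands of free modules. No generality is lost by taking
  the index set \<open>X\<close> in the type of elements of \<open>P\<close>: the choice \<open>X = carrier P\<close> always suffices.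
\<close>

definition projective_lmodule ::
    "('r, 'x) ring_scheme \<Rightarrow> ('r, 'p, 'y) module_scheme \<Rightarrow> bool" where
  "projective_lmodule R P \<longleftrightarrow>
    lmodule R P \<and>
    (\<exists>(X :: 'p set) incl proj.
      incl \<in> lmod_hom R P (free_lmodule R X) \<and>
      proj \<in> lmod_hom R (free_lmodule R X) P \<and>
      (\<forall>x\<in>carrier P. proj (incl x) = x))"

text \<open>An exact sequence \<open>\<dots> \<rightarrow> P 2 \<rightarrow> P 1 \<rightarrow> P 0 \<rightarrow> M \<rightarrow> 0\<close> with \<open>d i : P (i+1) \<rightarrow> P i\<close> and \<open>e : P 0 \<rightarrow> M\<close>.\<close>

definition projective_resolution ::
    "('r, 'x) ring_scheme \<Rightarrow> ('r, 'm, 'y) module_scheme \<Rightarrow>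
     (nat \<Rightarrow> ('r, 'p) module) \<Rightarrow> (nat \<Rightarrow> 'p \<Rightarrow> 'p) \<Rightarrow> ('p \<Rightarrow> 'm) \<Rightarrow> bool" where
  "projective_resolution R M P d e \<longleftrightarrow>
    (\<forall>i. projective_lmodule R (P i)) \<and>
    e \<in> lmod_hom R (P 0) M \<and>
    (\<forall>i. d i \<in> lmod_hom R (P (Suc i)) (P i)) \<and>
    e ` carrier (P 0) = carrier M \<and>
    d 0 ` carrier (P 1) = {x \<in> carrier (P 0). e x = \<zero>\<^bsub>M\<^esub>} \<and>
    (\<forall>i. d (Suc i) ` carrier (P (Suc (Suc i))) =
         {x \<in> carrier (P (Suc i)). d i x = \<zero>\<^bsub>P i\<^esub>})"

text \<open>
  HOL cannot quantify over types, so the terms of the resolution are taken in the fixed type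
  \<open>nat \<times> 'm \<Rightarrow> 'r\<close>. This is no restriction. Covering each syzygy by the free module on its
  elements produces only modules whose cardinality is at most the maximum of those of \<open>nat\<close>, \<open>'m\<close>
  and \<open>'r\<close>; if \<open>'r\<close> has more than one element, they all embed into \<open>nat \<times> 'm \<Rightarrow> 'r\<close>, and
  otherwise every module is zero. If the projective dimension is finite, this resolution can be
  cut off at a projective syzygy.
\<close>

definition finite_proj_dim ::
    "('r, 'x) ring_scheme \<Rightarrow> ('r, 'm, 'y) module_scheme \<Rightarrow> bool" where
  "finite_proj_dim R M \<longleftrightarrow>
    (\<exists>(P :: nat \<Rightarrow> ('r, nat \<times> 'm \<Rightarrow> 'r) module) d e.
      projective_resolution R M P d e \<and>
      (\<exists>n. \<forall>i>n. carrier (P i) = {\<zero>\<^bsub>P i\<^esub>}))"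

definition ideal_module :: "('r, 'x) ring_scheme \<Rightarrow> 'r set \<Rightarrow> ('r, 'r) module" where
  "ideal_module R J =
    \<lparr>carrier = J, mult = mult R, one = one R, zero = zero R, add = add R, smult = mult R\<rparr>"

definition finite_left_proj_dim :: "('r, 'x) ring_scheme \<Rightarrow> 'r set \<Rightarrow> bool" where
  "finite_left_proj_dim R J \<longleftrightarrow> finite_proj_dim R (ideal_module R J)"

definition finite_right_proj_dim :: "('r, 'x) ring_scheme \<Rightarrow> 'r set \<Rightarrow> bool" where
  "finite_right_proj_dim R J \<longleftrightarrow>
    finite_proj_dim (opposite_ring R) (ideal_module (opposite_ring R) J)"


section \<open>Path algebras and bound quivers\<close>

text \<open>
  A quiver is a finite directed multigraph, i.e. a \<^locale>\<open>fin_digraph\<close>; the arrow \<open>a\<close> goes from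
  \<open>tail Q a\<close> to \<open>head Q a\<close>. A path is given by its starting vertex and its list of arrows, so
  that \<open>(v, [])\<close> is the trivial path at \<open>v\<close>.
\<close>

type_synonym ('v, 'a) qpath = "'v \<times> 'a list"

definition qpaths :: "('v, 'a) pre_digraph \<Rightarrow> ('v, 'a) qpath set" where
  "qpaths Q = {(u, p). \<exists>v. pre_digraph.awalk Q u p v}"

definition qpath_target :: "('v, 'a) pre_digraph \<Rightarrow> ('v, 'a) qpath \<Rightarrow> 'v" where
  "qpath_target Q x = last (pre_digraph.awalk_verts Q (fst x) (snd x))"

definition path_elem :: "('v, 'a) qpath \<Rightarrow> ('v, 'a) qpath \<Rightarrow>\<^sub>0 'k::field" where
  "path_elem x = Poly_Mapping.single x 1"

definition arrow_elem :: "('v, 'a) pre_digraph \<Rightarrow> 'a \<Rightarrow> ('v, 'a) qpath \<Rightarrow>\<^sub>0 'k::field" where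
  "arrow_elem Q a = path_elem (tail Q a, [a])"

text \<open>The bilinear extension of the composition of paths from left to right.\<close>

definition path_mult ::
    "('v, 'a) pre_digraph \<Rightarrow> (('v, 'a) qpath \<Rightarrow>\<^sub>0 'k::field) \<Rightarrow> (('v, 'a) qpath \<Rightarrow>\<^sub>0 'k) \<Rightarrow> (('v, 'a) qpath \<Rightarrow>\<^sub>0 'k)"
  where
  "path_mult Q f g =
    (\<Sum>x\<in>Poly_Mapping.keys f. \<Sum>y\<in>Poly_Mapping.keys g.
      if qpath_target Q x = fst y
      then Poly_Mapping.single (fst x, snd x @ snd y)
             (Poly_Mapping.lookup f x * Poly_Mapping.lookup g y)
      else 0)"

definition path_algebra ::
    "('v, 'a) pre_digraph \<Rightarrow> (('v, 'a) qpath \<Rightarrow>\<^sub>0 'k::field) ring" where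
  "path_algebra Q =
    \<lparr>carrier = {f. Poly_Mapping.keys f \<subseteq> qpaths Q},
     mult = path_mult Q, one = (\<Sum>v\<in>verts Q. path_elem (v, [])),
     zero = 0, add = (+)\<rparr>"

definition admissible_ideal ::
    "('v, 'a) pre_digraph \<Rightarrow> (('v, 'a) qpath \<Rightarrow>\<^sub>0 'k::field) set \<Rightarrow> bool" where
  "admissible_ideal Q I \<longleftrightarrow>
    ideal I (path_algebra Q) \<and>
    (\<forall>z\<in>I. \<forall>x\<in>Poly_Mapping.keys z. length (snd x) \<ge> 2) \<and>
    (\<exists>N>1. \<forall>x\<in>qpaths Q. length (snd x) = N \<longrightarrow> path_elem x \<in> I)"

definition bound_quiver ::
    "('v, 'a) pre_digraph \<Rightarrow> (('v, 'a) qpath \<Rightarrow>\<^sub>0 'k::field) set \<Rightarrow> bool" where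
  "bound_quiver Q I \<longleftrightarrow> fin_digraph Q \<and> admissible_ideal Q I"

definition bound_quiver_algebra ::
    "('v, 'a) pre_digraph \<Rightarrow> (('v, 'a) qpath \<Rightarrow>\<^sub>0 'k::field) set \<Rightarrow> (('v, 'a) qpath \<Rightarrow>\<^sub>0 'k) set ring"
  where
  "bound_quiver_algebra Q I = path_algebra Q Quot I"

definition squared_zero_loop ::
    "('v, 'a) pre_digraph \<Rightarrow> (('v, 'a) qpath \<Rightarrow>\<^sub>0 'k::field) set \<Rightarrow> 'a \<Rightarrow> 'v \<Rightarrow> bool" where
  "squared_zero_loop Q I l i \<longleftrightarrow>
    l \<in> arcs Q \<and> tail Q l = i \<and> head Q l = i \<and>
    arrow_elem Q l \<otimes>\<^bsub>path_algebra Q\<^esub> arrow_elem Q l \<in> I"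


section \<open>Removable sets of arrows\<close>

definition arrow_ideal ::
    "('v, 'a) pre_digraph \<Rightarrow> (('v, 'a) qpath \<Rightarrow>\<^sub>0 'k::field) set \<Rightarrow> 'a set \<Rightarrow> (('v, 'a) qpath \<Rightarrow>\<^sub>0 'k) set set"
  where
  "arrow_ideal Q I A =
    Idl\<^bsub>bound_quiver_algebra Q I\<^esub> ((\<lambda>a. I +>\<^bsub>path_algebra Q\<^esub> arrow_elem Q a) ` A)"

definition restrict_keys :: "('b \<Rightarrow> bool) \<Rightarrow> ('b \<Rightarrow>\<^sub>0 'k) \<Rightarrow> ('b \<Rightarrow>\<^sub>0 'k::comm_monoid_add)" where
  "restrict_keys P z =
    (\<Sum>x\<in>{x \<in> Poly_Mapping.keys z. P x}. Poly_Mapping.single x (Poly_Mapping.lookup z x))"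

definition avoids :: "'a set \<Rightarrow> ('v, 'a) qpath \<Rightarrow> bool" where
  "avoids A x \<longleftrightarrow> set (snd x) \<inter> A = {}"

definition through_part ::
    "'a set \<Rightarrow> (('v, 'a) qpath \<Rightarrow>\<^sub>0 'k::field) \<Rightarrow> (('v, 'a) qpath \<Rightarrow>\<^sub>0 'k)" where
  "through_part A z = restrict_keys (\<lambda>x. \<not> avoids A x) z"

definition avoiding_part ::
    "'a set \<Rightarrow> (('v, 'a) qpath \<Rightarrow>\<^sub>0 'k::field) \<Rightarrow> (('v, 'a) qpath \<Rightarrow>\<^sub>0 'k)" where
  "avoiding_part A z = restrict_keys (avoids A) z"

definition pre_removable ::
    "('v, 'a) pre_digraph \<Rightarrow> (('v, 'a) qpath \<Rightarrow>\<^sub>0 'k::field) set \<Rightarrow> 'a set \<Rightarrow> bool" where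
  "pre_removable Q I A \<longleftrightarrow>
    A \<subseteq> arcs Q \<and> (\<forall>z\<in>I. through_part A z \<in> I \<and> avoiding_part A z \<in> I)"

definition two_sided_removable ::
    "('v, 'a) pre_digraph \<Rightarrow> (('v, 'a) qpath \<Rightarrow>\<^sub>0 'k::field) set \<Rightarrow> 'a set \<Rightarrow> bool" where
  "two_sided_removable Q I A \<longleftrightarrow>
    pre_removable Q I A \<and>
    finite_left_proj_dim (bound_quiver_algebra Q I) (arrow_ideal Q I A) \<and>
    finite_right_proj_dim (bound_quiver_algebra Q I) (arrow_ideal Q I A)"

definition only_left_removable ::
    "('v, 'a) pre_digraph \<Rightarrow> (('v, 'a) qpath \<Rightarrow>\<^sub>0 'k::field) set \<Rightarrow> 'a set \<Rightarrow> bool" where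
  "only_left_removable Q I A \<longleftrightarrow>
    pre_removable Q I A \<and>
    ideal_prod (bound_quiver_algebra Q I) (arrow_ideal Q I A) (arrow_ideal Q I A)
      = {\<zero>\<^bsub>bound_quiver_algebra Q I\<^esub>} \<and>
    finite_right_proj_dim (bound_quiver_algebra Q I) (arrow_ideal Q I A) \<and>
    \<not> finite_left_proj_dim (bound_quiver_algebra Q I) (arrow_ideal Q I A)"

definition removable ::
    "('v, 'a) pre_digraph \<Rightarrow> (('v, 'a) qpath \<Rightarrow>\<^sub>0 'k::field) set \<Rightarrow> 'a set \<Rightarrow> bool" where
  "removable Q I A \<longleftrightarrow> two_sided_removable Q I A \<or> only_left_removable Q I A"

text \<open>
  For pre-removable \<open>A\<close>, the pair \<open>(delete_arrows Q A, avoiding_ideal I A)\<close> is the canonical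
  representation of the quotient of the bound quiver algebra by \<open>arrow_ideal Q I A\<close>.
\<close>

definition delete_arrows :: "('v, 'a) pre_digraph \<Rightarrow> 'a set \<Rightarrow> ('v, 'a) pre_digraph" where
  "delete_arrows Q A = Q\<lparr>arcs := arcs Q - A\<rparr>"

definition avoiding_ideal ::
    "(('v, 'a) qpath \<Rightarrow>\<^sub>0 'k::field) set \<Rightarrow> 'a set \<Rightarrow> (('v, 'a) qpath \<Rightarrow>\<^sub>0 'k) set" where
  "avoiding_ideal I A = {z \<in> I. \<forall>x\<in>Poly_Mapping.keys z. avoids A x}"

definition removable_in_quotient ::
    "('v, 'a) pre_digraph \<Rightarrow> (('v, 'a) qpath \<Rightarrow>\<^sub>0 'k::field) set \<Rightarrow> 'a set \<Rightarrow> 'a set \<Rightarrow> bool" where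
  "removable_in_quotient Q I A B \<longleftrightarrow>
    B \<subseteq> arcs Q - A \<and> removable (delete_arrows Q A) (avoiding_ideal I A) B"

text \<open>
  The list \<open>As\<close> is the ordered partition. Its blocks are pairwise disjoint because
  \<open>As ! r\<close> is required to avoid the union of the preceding blocks; this union is automatically
  pre-removable (see \<open>pre_removable_Un\<close> below).
\<close>

definition eventually_removable_set ::
    "('v, 'a) pre_digraph \<Rightarrow> (('v, 'a) qpath \<Rightarrow>\<^sub>0 'k::field) set \<Rightarrow> 'a set \<Rightarrow> bool" where
  "eventually_removable_set Q I A \<longleftrightarrow>
    (\<exists>As. A = \<Union>(set As) \<and>
      (\<forall>r<length As. removable_in_quotient Q I (\<Union>(set (take r As))) (As ! r)))"

definition maximal_eventually_removable_set ::
    "('v, 'a) pre_digraph \<Rightarrow> (('v, 'a) qpath \<Rightarrow>\<^sub>0 'k::field) set \<Rightarrow> 'a set \<Rightarrow> bool" where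
  "maximal_eventually_removable_set Q I A \<longleftrightarrow>
    eventually_removable_set Q I A \<and>
    (\<forall>B. eventually_removable_set Q I B \<and> A \<subseteq> B \<longrightarrow> B = A)"

definition eventually_removable_arrow ::
    "('v, 'a) pre_digraph \<Rightarrow> (('v, 'a) qpath \<Rightarrow>\<^sub>0 'k::field) set \<Rightarrow> 'a \<Rightarrow> bool" where
  "eventually_removable_arrow Q I a \<longleftrightarrow>
    (\<exists>A. maximal_eventually_removable_set Q I A \<and> a \<in> A)"


section \<open>Basic facts\<close>

lemma qpath_target_append:
  "qpath_target Q (u, p @ q) = qpath_target Q (qpath_target Q (u, p), q)"
proof (induction p arbitrary: u)
  case Nil
  then show ?case by (simp add: qpath_target_def pre_digraph.awalk_verts.simps)
next
  case (Cons a p)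
  have ne: "pre_digraph.awalk_verts Q v r \<noteq> []" for v r
    by (cases r) (simp_all add: pre_digraph.awalk_verts.simps)
  from Cons[of "head Q a"] show ?case
    by (simp add: qpath_target_def pre_digraph.awalk_verts.simps ne)
qed

lemma qpath_target_Nil: "qpath_target Q (u, []) = u"
  by (simp add: qpath_target_def pre_digraph.awalk_verts.simps)

definition path_term ::
    "('v, 'a) pre_digraph \<Rightarrow> (('v, 'a) qpath \<Rightarrow>\<^sub>0 'k::field) \<Rightarrow> (('v, 'a) qpath \<Rightarrow>\<^sub>0 'k)
      \<Rightarrow> ('v, 'a) qpath \<Rightarrow> ('v, 'a) qpath \<Rightarrow> (('v, 'a) qpath \<Rightarrow>\<^sub>0 'k)" where
  "path_term Q f g x y =
    (if qpath_target Q x = fst y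
     then Poly_Mapping.single (fst x, snd x @ snd y)
            (Poly_Mapping.lookup f x * Poly_Mapping.lookup g y)
     else 0)"

lemma path_mult_superset:
  assumes "finite X" "finite Y" "Poly_Mapping.keys f \<subseteq> X" "Poly_Mapping.keys g \<subseteq> Y"
  shows "path_mult Q f g = (\<Sum>x\<in>X. \<Sum>y\<in>Y. path_term Q f g x y)"
proof -
  have "path_mult Q f g =
      (\<Sum>x\<in>Poly_Mapping.keys f. \<Sum>y\<in>Poly_Mapping.keys g. path_term Q f g x y)"
    by (simp add: path_mult_def path_term_def)
  also have "\<dots> = (\<Sum>x\<in>Poly_Mapping.keys f. \<Sum>y\<in>Y. path_term Q f g x y)"
    using assms
    by (intro sum.cong refl sum.mono_neutral_left) (auto simp: path_term_def in_keys_iff)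
  also have "\<dots> = (\<Sum>x\<in>X. \<Sum>y\<in>Y. path_term Q f g x y)"
    using assms
    by (intro sum.mono_neutral_left)
      (auto simp: path_term_def in_keys_iff intro!: sum.neutral)
  finally show ?thesis .
qed

lemma path_mult_add_left: "path_mult Q (f + g) h = path_mult Q f h + path_mult Q g h"
proof -
  let ?X = "Poly_Mapping.keys f \<union> Poly_Mapping.keys g" and ?Y = "Poly_Mapping.keys h"
  have "path_term Q (f + g) h x y = path_term Q f h x y + path_term Q g h x y" for x y
    by (simp add: path_term_def lookup_add distrib_right single_add)
  moreover have "Poly_Mapping.keys (f + g) \<subseteq> ?X" by (rule keys_add)
  ultimately show ?thesis
    by (simp add: path_mult_superset[of ?X ?Y] sum.distrib)
qed

lemma path_mult_add_right: "path_mult Q h (f + g) = path_mult Q h f + path_mult Q h g"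
proof -
  let ?X = "Poly_Mapping.keys f \<union> Poly_Mapping.keys g" and ?Y = "Poly_Mapping.keys h"
  have "path_term Q h (f + g) x y = path_term Q h f x y + path_term Q h g x y" for x y
    by (simp add: path_term_def lookup_add distrib_left single_add)
  moreover have "Poly_Mapping.keys (f + g) \<subseteq> ?X" by (rule keys_add)
  ultimately show ?thesis
    by (simp add: path_mult_superset[of ?Y ?X] sum.distrib)
qed

lemma path_mult_zero [simp]: "path_mult Q 0 g = 0" "path_mult Q f 0 = 0"
  by (simp_all add: path_mult_def)

lemma path_mult_sum_left: "path_mult Q (\<Sum>x\<in>X. f x) g = (\<Sum>x\<in>X. path_mult Q (f x) g)"
  by (induction X rule: infinite_finite_induct) (simp_all add: path_mult_add_left)

lemma path_mult_sum_right: "path_mult Q g (\<Sum>x\<in>X. f x) = (\<Sum>x\<in>X. path_mult Q g (f x))"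
  by (induction X rule: infinite_finite_induct) (simp_all add: path_mult_add_right)

lemma path_mult_single:
  "path_mult Q (Poly_Mapping.single x a) (Poly_Mapping.single y b) =
    (if qpath_target Q x = fst y then Poly_Mapping.single (fst x, snd x @ snd y) (a * b) else 0)"
  by (subst path_mult_superset[of "{x}" "{y}"]) (simp_all add: path_term_def)

lemma poly_mapping_sum_single:
  "f = (\<Sum>x\<in>Poly_Mapping.keys f. Poly_Mapping.single x (Poly_Mapping.lookup f x))"
  by (rule poly_mapping_eqI)
    (auto simp: lookup_sum lookup_single when_def in_keys_iff)

lemma path_mult_assoc: "path_mult Q (path_mult Q f g) h = path_mult Q f (path_mult Q g h)"
proof -
  have s: "path_mult Q (path_mult Q (Poly_Mapping.single x a) (Poly_Mapping.single y b))
              (Poly_Mapping.single z c) =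
            path_mult Q (Poly_Mapping.single x a)
              (path_mult Q (Poly_Mapping.single y b) (Poly_Mapping.single z c))" for x y z a b c
    using qpath_target_append[of Q "fst x" "snd x" "snd y"]
    by (auto simp: path_mult_single mult.assoc)
  show ?thesis
    apply (subst (1 2) poly_mapping_sum_single[of f])
    apply (subst (1 2) poly_mapping_sum_single[of g])
    apply (subst (1 2) poly_mapping_sum_single[of h])
    apply (simp only: path_mult_sum_left path_mult_sum_right s)
    done
qed

lemma keys_path_mult:
  assumes "z \<in> Poly_Mapping.keys (path_mult Q f g)"
  obtains x y where "x \<in> Poly_Mapping.keys f" "y \<in> Poly_Mapping.keys g"
    "qpath_target Q x = fst y" "z = (fst x, snd x @ snd y)"
proof -
  have "Poly_Mapping.keys (path_mult Q f g) \<subseteq>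
      (\<Union>x\<in>Poly_Mapping.keys f. Poly_Mapping.keys (\<Sum>y\<in>Poly_Mapping.keys g. path_term Q f g x y))"
    unfolding path_mult_def path_term_def[symmetric] by (rule keys_sum)
  also have "\<dots> \<subseteq>
      (\<Union>x\<in>Poly_Mapping.keys f. \<Union>y\<in>Poly_Mapping.keys g. Poly_Mapping.keys (path_term Q f g x y))"
    by (intro UN_mono order.refl keys_sum)
  finally obtain x y where
    xy: "x \<in> Poly_Mapping.keys f" "y \<in> Poly_Mapping.keys g"
      "z \<in> Poly_Mapping.keys (path_term Q f g x y)"
    using assms by blast
  from xy(3) have "qpath_target Q x = fst y" "z = (fst x, snd x @ snd y)"
    by (auto simp: path_term_def split: if_splits)
  with xy that show ?thesis by blast
qed

lemma qpaths_iff: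
  "(u, p) \<in> qpaths Q \<longleftrightarrow> pre_digraph.awalk Q u p (qpath_target Q (u, p))"
proof -
  have "last (pre_digraph.awalk_verts Q u p) = v" if "pre_digraph.cas Q u p v" for v
    using that
    by (induction p arbitrary: u)
      (auto simp: pre_digraph.cas.simps pre_digraph.awalk_verts.simps split: if_splits,
       metis list.distinct(1) neq_Nil_conv pre_digraph.awalk_verts.simps)
  then show ?thesis
    by (auto simp: qpaths_def qpath_target_def pre_digraph.awalk_def)
qed

lemma qpath_target_in_verts:
  assumes "wf_digraph Q" "x \<in> qpaths Q"
  shows "qpath_target Q x \<in> verts Q"
proof -
  interpret wf_digraph Q by fact
  show ?thesis using assms(2) by (cases x) (auto simp: qpaths_iff)
qed

lemma ring_path_algebra:
  assumes "fin_digraph Q"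
  shows "ring (path_algebra Q :: (('v, 'a) qpath \<Rightarrow>\<^sub>0 'k::field) ring)"
proof -
  interpret fin_digraph Q by fact
  let ?R = "path_algebra Q :: (('v, 'a) qpath \<Rightarrow>\<^sub>0 'k::field) ring"
  let ?one = "(\<Sum>v\<in>verts Q. path_elem (v, [])) :: ('v, 'a) qpath \<Rightarrow>\<^sub>0 'k"
  have ag: "abelian_group ?R"
  proof (rule abelian_groupI)
    fix f g assume "f \<in> carrier ?R" "g \<in> carrier ?R"
    then show "f \<oplus>\<^bsub>?R\<^esub> g \<in> carrier ?R"
      using keys_add[of f g] by (auto simp: path_algebra_def)
  next
    fix f assume f: "f \<in> carrier ?R"
    show "\<exists>g\<in>carrier ?R. g \<oplus>\<^bsub>?R\<^esub> f = \<zero>\<^bsub>?R\<^esub>"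
      using f by (intro bexI[of _ "- f"]) (auto simp: path_algebra_def)
  qed (simp_all add: path_algebra_def algebra_simps)
  have closed: "path_mult Q f g \<in> carrier ?R" if "f \<in> carrier ?R" "g \<in> carrier ?R" for f g
  proof -
    have "z \<in> qpaths Q" if "z \<in> Poly_Mapping.keys (path_mult Q f g)" for z
      using that
    proof (rule keys_path_mult)
      fix x y assume *: "x \<in> Poly_Mapping.keys f" "y \<in> Poly_Mapping.keys g"
        "qpath_target Q x = fst y" "z = (fst x, snd x @ snd y)"
      with \<open>f \<in> carrier ?R\<close> \<open>g \<in> carrier ?R\<close> have "x \<in> qpaths Q" "y \<in> qpaths Q"
        by (auto simp: path_algebra_def)
      then have "awalk (fst x) (snd x) (fst y)" "awalk (fst y) (snd y) (qpath_target Q y)"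
        using *(3) qpaths_iff[of "fst x" "snd x" Q] qpaths_iff[of "fst y" "snd y" Q] by simp_all
      then have "awalk (fst x) (snd x @ snd y) (qpath_target Q y)"
        by (rule awalk_appendI)
      then show "z \<in> qpaths Q" using *(4) by (auto simp: qpaths_def)
    qed
    then show ?thesis by (auto simp: path_algebra_def)
  qed
  have one_closed: "?one \<in> carrier ?R"
  proof -
    have "Poly_Mapping.keys ?one \<subseteq> (\<Union>v\<in>verts Q. {(v, [])})"
      by (rule order.trans[OF keys_sum]) (auto simp: path_elem_def)
    also have "\<dots> \<subseteq> qpaths Q"
      by (auto simp: qpaths_def awalk_def)
    finally show ?thesis by (simp add: path_algebra_def)
  qed
  have l: "path_mult Q ?one f = f" if "f \<in> carrier ?R" for f
  proof -
    have "path_mult Q ?one (Poly_Mapping.single x (Poly_Mapping.lookup f x)) =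
        Poly_Mapping.single x (Poly_Mapping.lookup f x)"
      if "x \<in> Poly_Mapping.keys f" for x
    proof -
      have "x \<in> qpaths Q" using that \<open>f \<in> carrier ?R\<close> by (auto simp: path_algebra_def)
      then have "fst x \<in> verts Q" by (auto simp: qpaths_def awalk_def)
      then show ?thesis
        by (simp add: path_mult_sum_left path_elem_def path_mult_single qpath_target_Nil)
    qed
    then show ?thesis
      by (subst (1 2) poly_mapping_sum_single[of f])
        (simp add: path_mult_sum_right cong: sum.cong)
  qed
  have r: "path_mult Q f ?one = f" if "f \<in> carrier ?R" for f
  proof -
    have "path_mult Q (Poly_Mapping.single x (Poly_Mapping.lookup f x)) ?one =
        Poly_Mapping.single x (Poly_Mapping.lookup f x)"
      if "x \<in> Poly_Mapping.keys f" for x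
    proof -
      have "x \<in> qpaths Q" using that \<open>f \<in> carrier ?R\<close> by (auto simp: path_algebra_def)
      then have "qpath_target Q x \<in> verts Q"
        by (rule qpath_target_in_verts[OF wf_digraph_axioms])
      then show ?thesis
        by (simp add: path_mult_sum_right path_elem_def path_mult_single)
    qed
    then show ?thesis
      by (subst (1 2) poly_mapping_sum_single[of f])
        (simp add: path_mult_sum_left cong: sum.cong)
  qed
  have sel: "mult ?R = path_mult Q" "one ?R = ?one" "add ?R = (+)"
    by (simp_all add: path_algebra_def)
  show ?thesis
  proof (rule ringI[OF ag])
    show "monoid ?R"
      by (rule monoidI; unfold sel)
        (rule closed one_closed l r path_mult_assoc; assumption?)+
  qed (simp_all only: sel path_mult_add_left path_mult_add_right)
qed

lemma ring_bound_quiver_algebra: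
  assumes "bound_quiver Q I"
  shows "ring (bound_quiver_algebra Q I)"
proof -
  have "ideal I (path_algebra Q)"
    using assms unfolding bound_quiver_def admissible_ideal_def by blast
  then show ?thesis
    unfolding bound_quiver_algebra_def by (rule ideal.quotient_is_ring)
qed

lemma ring_opposite_ring:
  assumes "ring R"
  shows "ring (opposite_ring R)"
proof -
  interpret ring R by fact
  have sel: "carrier (opposite_ring R) = carrier R" "add (opposite_ring R) = add R"
    "zero (opposite_ring R) = zero R" "one (opposite_ring R) = one R"
    "mult (opposite_ring R) = (\<lambda>a b. b \<otimes>\<^bsub>R\<^esub> a)"
    by (simp_all add: opposite_ring_def)
  show ?thesis
    by (intro ringI abelian_groupI monoidI; (unfold sel)?)
      (auto simp: a_ac m_assoc l_distr r_distr intro: l_neg)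
qed

lemma lmodule_ideal_module:
  assumes "ideal J R"
  shows "lmodule R (ideal_module R J)"
proof -
  interpret ideal J R by fact
  have "abelian_group (ideal_module R J)"
  proof (rule abelian_groupI)
    fix x assume "x \<in> carrier (ideal_module R J)"
    then show "\<exists>y\<in>carrier (ideal_module R J).
        y \<oplus>\<^bsub>ideal_module R J\<^esub> x = \<zero>\<^bsub>ideal_module R J\<^esub>"
      by (intro bexI[of _ "\<ominus>\<^bsub>R\<^esub> x"]) (auto simp: ideal_module_def l_neg)
  qed (auto simp: ideal_module_def intro: a_assoc a_comm)
  then show ?thesis
    by (intro lmodule.intro ring_axioms lmodule_axioms.intro)
      (auto simp: ideal_module_def I_l_closed l_distr r_distr m_assoc)
qed

lemma ideal_opposite_ring:
  assumes "ideal J R"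
  shows "ideal J (opposite_ring R)"
proof -
  interpret ideal J R by fact
  have "add_monoid (opposite_ring R) = add_monoid R"
    by (simp add: opposite_ring_def)
  then show ?thesis
    by (intro idealI ring_opposite_ring ring_axioms)
      (simp_all add: a_subgroup, simp_all add: opposite_ring_def I_l_closed I_r_closed)
qed

lemma lookup_restrict_keys:
  "Poly_Mapping.lookup (restrict_keys P z) x = (if P x then Poly_Mapping.lookup z x else 0)"
proof -
  have "finite {y \<in> Poly_Mapping.keys z. P y}" by simp
  then show ?thesis
    by (simp add: restrict_keys_def lookup_sum lookup_single when_def in_keys_iff)
qed

lemma through_part_plus_avoiding_part: "through_part A z + avoiding_part A z = z"
  by (rule poly_mapping_eqI)
    (simp add: through_part_def avoiding_part_def lookup_add lookup_restrict_keys)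

lemma pre_removable_Un:
  assumes "bound_quiver Q I" "pre_removable Q I A"
    "pre_removable (delete_arrows Q A) (avoiding_ideal I A) B"
  shows "pre_removable Q I (A \<union> B)"
proof -
  interpret ideal I "path_algebra Q"
    using assms(1) unfolding bound_quiver_def admissible_ideal_def by blast
  have sum: "x + y \<in> I" if "x \<in> I" "y \<in> I" for x y
    using additive_subgroup.a_closed[OF is_additive_subgroup that] by (simp add: path_algebra_def)
  have "through_part (A \<union> B) z \<in> I \<and> avoiding_part (A \<union> B) z \<in> I" if "z \<in> I" for z
  proof -
    let ?y = "avoiding_part A z"
    have keys: "avoids A x" if "x \<in> Poly_Mapping.keys ?y" for x
      using that by (auto simp: in_keys_iff avoiding_part_def lookup_restrict_keys split: if_splits)
    have y: "?y \<in> avoiding_ideal I A" and t: "through_part A z \<in> I"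
      using assms(2) \<open>z \<in> I\<close> keys by (auto simp: pre_removable_def avoiding_ideal_def)
    have *: "through_part B ?y \<in> I" "avoiding_part B ?y \<in> I"
      using assms(3) y by (auto simp: pre_removable_def avoiding_ideal_def)
    have "avoiding_part (A \<union> B) z = avoiding_part B ?y"
      by (rule poly_mapping_eqI)
        (auto simp: avoiding_part_def lookup_restrict_keys avoids_def)
    moreover have "through_part (A \<union> B) z = through_part A z + through_part B ?y"
      by (rule poly_mapping_eqI)
        (auto simp: avoiding_part_def through_part_def lookup_add lookup_restrict_keys avoids_def)
    ultimately show ?thesis using * t sum by simp
  qed
  moreover have "A \<union> B \<subseteq> arcs Q"
    using assms(2,3) by (auto simp: pre_removable_def delete_arrows_def)
  ultimately show ?thesis by (simp add: pre_removable_def)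
qed

end

theory Submission
  imports Defs
begin

text \<open>
  The coefficients at \<open>e\<^sub>i\<close> and at \<open>l\<close> define a homomorphism from \<open>\<Lambda>\<close> to the dual numbers
  \<open>D = k[\<epsilon>]/(\<epsilon>\<^sup>2)\<close>. Let \<open>M\<close> be a right module with an element \<open>m\<close> such that \<open>m l = 0\<close> and a
  homomorphism \<open>a : M \<rightarrow> S\<^sub>i\<close> with \<open>a m \<noteq> 0\<close>. For an epimorphism
  \<open>P \<rightarrow> M\<close> with \<open>P\<close> projective and \<open>p \<mapsto> m\<close>, the composite \<open>P \<rightarrow> M \<rightarrow> S\<^sub>i\<close> lifts to \<open>P \<rightarrow> D\<close>; the lift
  maps the kernel to \<open>\<epsilon> D \<cong> S\<^sub>i\<close> and does not vanish at \<open>p l\<close>, which lies in the kernel and is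
  annihilated by \<open>l\<close>. So the kernel has the same property, no syzygy of \<open>M\<close> vanishes, and \<open>M\<close> has
  infinite projective dimension.

  If \<open>\<alpha> l \<in> I\<close> and \<open>\<alpha> \<in> A\<close>, this applies to \<open>\<langle>A + I\<rangle>\<close> as a right module, with \<open>m\<close> the coset of \<open>\<alpha>\<close>
  and \<open>a\<close> the coefficient at \<open>\<alpha>\<close>; both kinds of removability require finite projective dimension on
  the right. If \<open>l\<close> is removed before \<open>\<alpha>\<close>, take \<open>l\<close> in place of \<open>\<alpha>\<close>.
\<close>

section \<open>Nonvanishing syzygies\<close>

text \<open>Homomorphisms into the one-dimensional module on which \<open>s\<close> acts as the
  scalar \<open>\<chi> s\<close>. The subset \<open>K\<close> is kept apart from the carrier of
  \<open>N\<close> so that a syzygy can be handled inside its projective module, without a module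
  record of its own.\<close>

definition char_functional ::
    "('r, 'x) ring_scheme \<Rightarrow> ('r \<Rightarrow> 'k::field) \<Rightarrow> ('r, 'm, 'y) module_scheme \<Rightarrow> 'm set \<Rightarrow> ('m \<Rightarrow> 'k) \<Rightarrow> bool"
  where
  "char_functional S \<chi> N K a \<longleftrightarrow>
    (\<forall>x\<in>K. \<forall>y\<in>K. a (x \<oplus>\<^bsub>N\<^esub> y) = a x + a y) \<and>
    (\<forall>s\<in>carrier S. \<forall>x\<in>K. a (s \<odot>\<^bsub>N\<^esub> x) = \<chi> s * a x)"

lemma char_functional_add:
  "\<lbrakk>char_functional S \<chi> N K a; x \<in> K; y \<in> K\<rbrakk> \<Longrightarrow> a (x \<oplus>\<^bsub>N\<^esub> y) = a x + a y"
  by (simp add: char_functional_def)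

lemma char_functional_smult:
  "\<lbrakk>char_functional S \<chi> N K a; s \<in> carrier S; x \<in> K\<rbrakk> \<Longrightarrow> a (s \<odot>\<^bsub>N\<^esub> x) = \<chi> s * a x"
  by (simp add: char_functional_def)

lemma char_functional_comp:
  assumes f: "f \<in> lmod_hom S P N" and K: "f ` carrier P \<subseteq> K" and a: "char_functional S \<chi> N K a"
  shows "char_functional S \<chi> P (carrier P) (\<lambda>x. a (f x))"
proof -
  have "f x \<in> K" if "x \<in> carrier P" for x
    using K that by blast
  then show ?thesis
    using f a by (simp add: char_functional_def lmod_hom_def)
qed

section \<open>Functionals on free and projective modules\<close>

definition (in ring) free_basis :: "'i \<Rightarrow> 'i \<Rightarrow> 'a" where
  "free_basis y = (\<lambda>i. if i = y then \<one> else \<zero>)"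

lemma (in ring) free_basis_closed: "y \<in> X \<Longrightarrow> free_basis y \<in> carrier (free_lmodule R X)"
  by (auto simp: free_basis_def free_lmodule_def)

text \<open>
  The assumptions say that \<open>s \<mapsto> \<chi> s + \<delta> s \<epsilon>\<close> is a homomorphism to the dual numbers
  \<open>k[\<epsilon>]/(\<epsilon>\<^sup>2)\<close> with \<open>l \<mapsto> \<epsilon>\<close>.
\<close>

locale dual_number_character = ring R for R :: "('r, 'x) ring_scheme" (structure) +
  fixes \<chi> \<delta> :: "'r \<Rightarrow> 'k::field" and l :: 'r
  assumes chi_add: "\<lbrakk>s \<in> carrier R; t \<in> carrier R\<rbrakk> \<Longrightarrow> \<chi> (s \<oplus> t) = \<chi> s + \<chi> t"
    and chi_mult: "\<lbrakk>s \<in> carrier R; t \<in> carrier R\<rbrakk> \<Longrightarrow> \<chi> (s \<otimes> t) = \<chi> s * \<chi> t"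
    and delta_add: "\<lbrakk>s \<in> carrier R; t \<in> carrier R\<rbrakk> \<Longrightarrow> \<delta> (s \<oplus> t) = \<delta> s + \<delta> t"
    and delta_mult: "\<lbrakk>s \<in> carrier R; t \<in> carrier R\<rbrakk> \<Longrightarrow> \<delta> (s \<otimes> t) = \<chi> s * \<delta> t + \<delta> s * \<chi> t"
    and l_closed: "l \<in> carrier R"
    and l_square: "l \<otimes> l = \<zero>"
    and chi_l: "\<chi> l = 0"
    and delta_l: "\<delta> l = 1"
begin

lemma chi_zero: "\<chi> \<zero> = 0" and delta_zero: "\<delta> \<zero> = 0"
  by (metis chi_add l_zero zero_closed add_cancel_right_right)
    (metis delta_add l_zero zero_closed add_cancel_right_right)

lemma char_functional_zero:
  assumes "char_functional R \<chi> N K a" "lmodule R N" "x \<in> K" "K \<subseteq> carrier N"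
  shows "a \<zero>\<^bsub>N\<^esub> = 0"
proof -
  interpret N: lmodule R N by fact
  have x: "x \<in> carrier N" using assms by blast
  \<comment> \<open>Zero need not lie in \<open>K\<close>, so it is reached as the zero multiple of
    \<open>x\<close>, to which the scalar rule for \<open>a\<close> applies.\<close>
  have "\<zero> \<odot>\<^bsub>N\<^esub> x \<oplus>\<^bsub>N\<^esub> \<zero> \<odot>\<^bsub>N\<^esub> x = \<zero> \<odot>\<^bsub>N\<^esub> x"
    using N.smult_l_distr[of \<zero> \<zero> x] x by simp
  then have "\<zero> \<odot>\<^bsub>N\<^esub> x = \<zero>\<^bsub>N\<^esub>"
    using N.smult_closed[OF zero_closed x] N.M.add.l_cancel_one by simp
  moreover have "a (\<zero> \<odot>\<^bsub>N\<^esub> x) = 0"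
    using char_functional_smult[OF assms(1) zero_closed assms(3)] by (simp add: chi_zero)
  ultimately show ?thesis by simp
qed

text \<open>\<open>\<chi>\<close>-linear maps are determined on a basis. \<open>Y\<close> may exceed
  the support, so that the induction can clear one coordinate at a time; indices off the support
  contribute nothing because \<open>\<chi>\<close> vanishes at zero.\<close>

lemma char_functional_free_expand:
  assumes c: "char_functional R \<chi> (free_lmodule R X) (carrier (free_lmodule R X)) c"
    and "finite Y" "f \<in> carrier (free_lmodule R X)" "{y. f y \<noteq> \<zero>} \<subseteq> Y"
  shows "c f = (\<Sum>y\<in>Y. \<chi> (f y) * c (free_basis y))"
  using assms(2-)
proof (induction Y arbitrary: f)
  case empty
  let ?F = "free_lmodule R X"
  have "\<zero> \<odot>\<^bsub>?F\<^esub> f = f" using empty by (auto simp: free_lmodule_def)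
  then show ?case
    using char_functional_smult[OF c zero_closed empty(1)] by (simp add: chi_zero)
next
  case (insert y Y)
  let ?F = "free_lmodule R X"
  have f: "f i \<in> carrier R" for i
    using insert.prems(1) by (cases "i \<in> X") (auto simp: free_lmodule_def)
  show ?case
  proof (cases "f y = \<zero>")
    case True
    then have "{y. f y \<noteq> \<zero>} \<subseteq> Y" using insert.prems(2) by auto
    then show ?thesis using insert.IH[OF insert.prems(1)] insert.hyps True by (simp add: chi_zero)
  next
    case False
    then have y: "y \<in> X" using insert.prems(1) by (auto simp: free_lmodule_def)
    let ?g = "f(y := \<zero>)" and ?h = "f y \<odot>\<^bsub>?F\<^esub> free_basis y"
    have "finite {i. ?g i \<noteq> \<zero>}"
      by (rule finite_subset[OF _ insert.hyps(1)]) (use insert.prems(2) in auto)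
    then have g: "?g \<in> carrier ?F" using insert.prems(1) by (auto simp: free_lmodule_def)
    have h: "?h \<in> carrier ?F" using y f by (auto simp: free_lmodule_def free_basis_def)
    have "c f = c (?g \<oplus>\<^bsub>?F\<^esub> ?h)"
      using f by (auto simp: free_lmodule_def free_basis_def fun_eq_iff intro!: arg_cong[of _ _ c])
    also have "\<dots> = c ?g + \<chi> (f y) * c (free_basis y)"
      using char_functional_add[OF c g h] char_functional_smult[OF c f free_basis_closed[OF y]] by simp
    also have "c ?g = (\<Sum>i\<in>Y. \<chi> (?g i) * c (free_basis i))"
      by (rule insert.IH[OF g]) (use insert.prems(2) in auto)
    also have "\<dots> = (\<Sum>i\<in>Y. \<chi> (f i) * c (free_basis i))"
      using insert.hyps by (intro sum.cong) auto
    finally show ?thesis using insert.hyps by (simp add: add.commute)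
  qed
qed

text \<open>The map \<open>a + b \<epsilon>\<close> lifts the homomorphism \<open>a\<close> from \<open>P\<close> to \<open>k\<close> along \<open>k[\<epsilon>]/(\<epsilon>\<^sup>2) \<rightarrow> k\<close>.\<close>

lemma projective_lift:
  fixes P :: "('r, 'p, 'y) module_scheme"
  assumes P: "projective_lmodule R P" and a: "char_functional R \<chi> P (carrier P) a"
  obtains b where
    "\<And>x y. \<lbrakk>x \<in> carrier P; y \<in> carrier P\<rbrakk> \<Longrightarrow> b (x \<oplus>\<^bsub>P\<^esub> y) = b x + b y"
    "\<And>s x. \<lbrakk>s \<in> carrier R; x \<in> carrier P\<rbrakk> \<Longrightarrow> b (s \<odot>\<^bsub>P\<^esub> x) = \<chi> s * b x + \<delta> s * a x"
proof -
  obtain X :: "'p set" and incl proj where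
    incl: "incl \<in> lmod_hom R P (free_lmodule R X)" and
    proj: "proj \<in> lmod_hom R (free_lmodule R X) P" and
    id: "\<And>x. x \<in> carrier P \<Longrightarrow> proj (incl x) = x"
    using P unfolding projective_lmodule_def by blast
  let ?F = "free_lmodule R X"
  define c where "c f = a (proj f)" for f
  have "proj ` carrier ?F \<subseteq> carrier P" using proj by (auto simp: lmod_hom_def)
  then have c: "char_functional R \<chi> ?F (carrier ?F) c"
    unfolding c_def by (rule char_functional_comp[OF proj _ a])
  define supp where "supp f = {y. f y \<noteq> \<zero>}" for f :: "'p \<Rightarrow> 'r"
  \<comment> \<open>Send each basis vector to the dual number \<open>c (free_basis y)\<close> with
    zero \<epsilon>-part and extend linearly: \<open>b\<close> is the \<epsilon>-part of the
    resulting map, restricted to \<open>P\<close> along \<open>incl\<close>.\<close>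
  define b where "b x = (\<Sum>y\<in>supp (incl x). \<delta> (incl x y) * c (free_basis y))" for x
  have inclF: "incl x \<in> carrier ?F" if "x \<in> carrier P" for x
    using incl that by (auto simp: lmod_hom_def)
  have inclR: "incl x y \<in> carrier R" if "x \<in> carrier P" for x y
    using inclF[OF that] by (cases "y \<in> X") (auto simp: free_lmodule_def)
  have fin: "finite (supp (incl x))" if "x \<in> carrier P" for x
    using inclF[OF that] by (auto simp: free_lmodule_def supp_def)
  have b_superset: "b x = (\<Sum>y\<in>Y. \<delta> (incl x y) * c (free_basis y))"
    if "finite Y" "supp (incl x) \<subseteq> Y" for x Y
    unfolding b_def using that
    by (intro sum.mono_neutral_left) (auto simp: supp_def delta_zero)
  have lmod: "lmodule R P" using P by (simp add: projective_lmodule_def)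
  then interpret P: lmodule R P .
  show thesis
  proof (rule that[of b])
    fix x y assume xy: "x \<in> carrier P" "y \<in> carrier P"
    have sum: "incl (x \<oplus>\<^bsub>P\<^esub> y) i = incl x i \<oplus> incl y i" for i
      using incl xy by (simp add: lmod_hom_def free_lmodule_def)
    let ?Y = "supp (incl x) \<union> supp (incl y)"
    have "finite ?Y" using fin xy by blast
    moreover have "supp (incl (x \<oplus>\<^bsub>P\<^esub> y)) \<subseteq> ?Y"
      by (auto simp: supp_def sum)
    ultimately show "b (x \<oplus>\<^bsub>P\<^esub> y) = b x + b y"
      using xy inclR
      by (simp add: b_superset[of ?Y] sum delta_add distrib_right sum.distrib)
  next
    fix s x assume sx: "s \<in> carrier R" "x \<in> carrier P"
    have smult: "incl (s \<odot>\<^bsub>P\<^esub> x) i = s \<otimes> incl x i" for i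
      using incl sx by (simp add: lmod_hom_def free_lmodule_def)
    let ?Y = "supp (incl x)"
    have Y: "finite ?Y" using fin sx by blast
    have "supp (incl (s \<odot>\<^bsub>P\<^esub> x)) \<subseteq> ?Y"
      using sx by (auto simp: supp_def smult)
    then have "b (s \<odot>\<^bsub>P\<^esub> x) = (\<Sum>y\<in>?Y. \<delta> (s \<otimes> incl x y) * c (free_basis y))"
      using b_superset[OF Y] by (simp add: smult)
    also have "\<dots> = \<chi> s * b x + \<delta> s * (\<Sum>y\<in>?Y. \<chi> (incl x y) * c (free_basis y))"
      using sx inclR
      by (simp add: b_def delta_mult distrib_right sum.distrib sum_distrib_left mult.assoc)
    also have "(\<Sum>y\<in>?Y. \<chi> (incl x y) * c (free_basis y)) = c (incl x)"
      using char_functional_free_expand[OF c Y inclF[OF sx(2)]] by (simp add: supp_def)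
    also have "\<dots> = a x" using id sx by (simp add: c_def)
    finally show "b (s \<odot>\<^bsub>P\<^esub> x) = \<chi> s * b x + \<delta> s * a x" .
  qed
qed

text \<open>The property inherited by syzygies: \<open>a\<close> plays the map to the simple module
  at the loop, \<open>m\<close> an element killed by the loop. It is relative to \<open>K\<close>
  because it is later applied to images of differentials.\<close>

definition detected :: "('r, 'm, 'y) module_scheme \<Rightarrow> 'm set \<Rightarrow> bool" where
  "detected N K \<longleftrightarrow>
    (\<exists>a m. char_functional R \<chi> N K a \<and> m \<in> K \<and> l \<odot>\<^bsub>N\<^esub> m = \<zero>\<^bsub>N\<^esub> \<and> a m \<noteq> 0)"

lemma detected_nonzero:
  assumes "detected N K" "lmodule R N" "K \<subseteq> carrier N"
  shows "\<exists>x\<in>K. x \<noteq> \<zero>\<^bsub>N\<^esub>"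
  using assms char_functional_zero unfolding detected_def by metis

text \<open>The new functional is the \<epsilon>-part \<open>b\<close> of a lift of the composite of
  \<open>a\<close> and \<open>f\<close>; the new element is \<open>l\<close> times a preimage
  \<open>p\<close> of \<open>m\<close>.\<close>

lemma detected_kernel:
  assumes N: "lmodule R N" and P: "projective_lmodule R P" and f: "f \<in> lmod_hom R P N"
    and K: "f ` carrier P = K" and det: "detected N K"
  shows "detected P {x \<in> carrier P. f x = \<zero>\<^bsub>N\<^esub>}"
proof -
  interpret N: lmodule R N by fact
  interpret P: lmodule R P using P by (simp add: projective_lmodule_def)
  obtain a m where a: "char_functional R \<chi> N K a" and m: "m \<in> K"
    "l \<odot>\<^bsub>N\<^esub> m = \<zero>\<^bsub>N\<^esub>" "a m \<noteq> 0"
    using det unfolding detected_def by blast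
  obtain p where p: "p \<in> carrier P" "f p = m" using m K by blast
  have af: "char_functional R \<chi> P (carrier P) (\<lambda>x. a (f x))"
    using char_functional_comp[OF f _ a] K by simp
  obtain b where b_add:
      "\<And>x y. \<lbrakk>x \<in> carrier P; y \<in> carrier P\<rbrakk> \<Longrightarrow> b (x \<oplus>\<^bsub>P\<^esub> y) = b x + b y"
    and b_smult: "\<And>s x. \<lbrakk>s \<in> carrier R; x \<in> carrier P\<rbrakk> \<Longrightarrow>
      b (s \<odot>\<^bsub>P\<^esub> x) = \<chi> s * b x + \<delta> s * a (f x)"
    using projective_lift[OF P af] by blast
  have fN: "f ` carrier P \<subseteq> carrier N" using f by (auto simp: lmod_hom_def)
  have a0: "a \<zero>\<^bsub>N\<^esub> = 0"
    using char_functional_zero[OF a N m(1)] K fN by blast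
  let ?K = "{x \<in> carrier P. f x = \<zero>\<^bsub>N\<^esub>}"
  \<comment> \<open>On the kernel \<open>a (f x) = 0\<close>, so the correction term
    \<open>\<delta> s * a (f x)\<close> disappears and \<open>b\<close> becomes
    \<open>\<chi>\<close>-linear.\<close>
  have "char_functional R \<chi> P ?K b"
    by (simp add: char_functional_def b_add b_smult a0)
  moreover have "l \<odot>\<^bsub>P\<^esub> p \<in> ?K"
    using f p m l_closed by (simp add: lmod_hom_def P.smult_closed)
  moreover have "l \<odot>\<^bsub>P\<^esub> (l \<odot>\<^bsub>P\<^esub> p) = \<zero>\<^bsub>P\<^esub>"
  proof -
    have "\<zero> \<odot>\<^bsub>P\<^esub> p \<oplus>\<^bsub>P\<^esub> \<zero> \<odot>\<^bsub>P\<^esub> p = \<zero> \<odot>\<^bsub>P\<^esub> p"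
      using P.smult_l_distr[of \<zero> \<zero> p] p by simp
    then have "\<zero> \<odot>\<^bsub>P\<^esub> p = \<zero>\<^bsub>P\<^esub>"
      using P.smult_closed[OF zero_closed p(1)] P.M.add.l_cancel_one by simp
    then show ?thesis
      using P.smult_assoc1[OF l_closed l_closed p(1)] l_square by simp
  qed
  \<comment> \<open>The value is \<open>\<chi> l * b p + \<delta> l * a m = a m\<close>.\<close>
  moreover have "b (l \<odot>\<^bsub>P\<^esub> p) \<noteq> 0"
    using b_smult[OF l_closed p(1)] p m by (simp add: chi_l delta_l)
  ultimately show ?thesis unfolding detected_def by blast
qed

theorem detected_infinite_proj_dim:
  fixes M :: "('r, 'm, 'y) module_scheme"
  assumes M: "lmodule R M" and det: "detected M (carrier M)"
  shows "\<not> finite_proj_dim R M"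
proof
  assume "finite_proj_dim R M"
  then obtain P :: "nat \<Rightarrow> ('r, nat \<times> 'm \<Rightarrow> 'r) module" and d e n
    where res: "projective_resolution R M P d e"
    and n: "\<And>i. i > n \<Longrightarrow> carrier (P i) = {\<zero>\<^bsub>P i\<^esub>}"
    unfolding finite_proj_dim_def by blast
  have proj: "projective_lmodule R (P i)" for i
    using res by (simp add: projective_resolution_def)
  then have lmod: "lmodule R (P i)" for i
    by (simp add: projective_lmodule_def)
  have d: "d i \<in> lmod_hom R (P (Suc i)) (P i)" for i
    using res by (simp add: projective_resolution_def)
  have e: "e \<in> lmod_hom R (P 0) M" "e ` carrier (P 0) = carrier M"
    using res by (simp_all add: projective_resolution_def)
  \<comment> \<open>By exactness each image is the kernel of the preceding map, so the property
    moves one step along the resolution.\<close>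
  have im: "detected (P i) (d i ` carrier (P (Suc i)))" for i
  proof (induction i)
    case 0
    show ?case
      using detected_kernel[OF M proj e det] res by (simp add: projective_resolution_def)
  next
    case (Suc i)
    show ?case
      using detected_kernel[OF lmod proj d refl Suc] res by (simp add: projective_resolution_def)
  qed
  \<comment> \<open>The term with index \<open>Suc n\<close> is the first one known to be zero, yet
    it contains a detected, hence nonzero, image.\<close>
  have "d (Suc n) ` carrier (P (Suc (Suc n))) \<subseteq> carrier (P (Suc n))"
    using d[of "Suc n"] by (auto simp: lmod_hom_def)
  with detected_nonzero[OF im[of "Suc n"] lmod] n[of "Suc n"] show False by auto
qed

end

text \<open>The dual numbers are commutative, so a homomorphism into them is also one from the
  opposite ring. This makes the criterion available for right modules.\<close>

lemma dual_number_character_opposite: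
  assumes "dual_number_character R \<chi> \<delta> l"
  shows "dual_number_character (opposite_ring R) \<chi> \<delta> l"
proof -
  interpret dual_number_character R \<chi> \<delta> l by fact
  show ?thesis
    by (intro dual_number_character.intro dual_number_character_axioms.intro
        ring_opposite_ring ring_axioms)
      (simp_all add: opposite_ring_def chi_add chi_mult delta_add delta_mult
        l_closed l_square chi_l delta_l)
qed

lemma (in ring) kernel_ideal:
  fixes \<chi> :: "'a \<Rightarrow> 'k::field"
  assumes add: "\<And>s t. \<lbrakk>s \<in> carrier R; t \<in> carrier R\<rbrakk> \<Longrightarrow> \<chi> (s \<oplus> t) = \<chi> s + \<chi> t"
    and mult: "\<And>s t. \<lbrakk>s \<in> carrier R; t \<in> carrier R\<rbrakk> \<Longrightarrow> \<chi> (s \<otimes> t) = \<chi> s * \<chi> t"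
  shows "ideal {x \<in> carrier R. \<chi> x = 0} R"
proof -
  have zero: "\<chi> \<zero> = 0"
    by (metis add l_zero zero_closed add_cancel_right_right)
  have minus: "\<chi> (\<ominus> x) = - \<chi> x" if "x \<in> carrier R" for x
    using add[OF that a_inv_closed[OF that]] that zero
    by (simp add: r_neg eq_neg_iff_add_eq_0 add.commute)
  have "subgroup {x \<in> carrier R. \<chi> x = 0} (add_monoid R)"
    by (rule subgroup.intro)
      (auto simp: add zero minus simp flip: a_inv_def)
  then show ?thesis
    by (intro idealI ring_axioms) (auto simp: mult)
qed


section \<open>Coefficients in a bound quiver algebra\<close>

text \<open>\<open>D\<close> lists the factorizations of \<open>z\<close> into two composable paths;
  the product is a convolution over them.\<close>

lemma lookup_path_mult:
  assumes "finite D" and D: "D = {(x, y). qpath_target Q x = fst y \<and> (fst x, snd x @ snd y) = z}"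
  shows "Poly_Mapping.lookup (path_mult Q f g) z =
    (\<Sum>(x, y)\<in>D. Poly_Mapping.lookup f x * Poly_Mapping.lookup g y)"
proof -
  \<comment> \<open>Adding the projections of \<open>D\<close> to the supports places all of
    \<open>D\<close> inside \<open>?X \<times> ?Y\<close>.\<close>
  let ?X = "Poly_Mapping.keys f \<union> fst ` D" and ?Y = "Poly_Mapping.keys g \<union> snd ` D"
  let ?t = "\<lambda>(x, y). Poly_Mapping.lookup f x * Poly_Mapping.lookup g y"
  have fin: "finite ?X" "finite ?Y" using assms(1) by simp_all
  have pt: "Poly_Mapping.lookup (path_term Q f g x y) z = (if (x, y) \<in> D then ?t (x, y) else 0)"
    for x y
    by (simp add: path_term_def D lookup_single when_def)
  have "Poly_Mapping.lookup (path_mult Q f g) z =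
      (\<Sum>x\<in>?X. \<Sum>y\<in>?Y. Poly_Mapping.lookup (path_term Q f g x y) z)"
    by (subst path_mult_superset[OF fin]) (simp_all add: lookup_sum)
  also have "\<dots> = (\<Sum>p\<in>?X \<times> ?Y. if p \<in> D then ?t p else 0)"
    by (simp add: sum.cartesian_product pt case_prod_beta cong: if_cong)
  also have "\<dots> = sum ?t ((?X \<times> ?Y) \<inter> D)"
    using fin by (simp add: sum.inter_restrict)
  also have "(?X \<times> ?Y) \<inter> D = D" by force
  finally show ?thesis .
qed

lemma lookup_path_mult_trivial:
  "Poly_Mapping.lookup (path_mult Q f g) (u, []) =
    Poly_Mapping.lookup f (u, []) * Poly_Mapping.lookup g (u, [])"
  by (subst lookup_path_mult[of "{((u, []), (u, []))}"]) (auto simp: qpath_target_Nil)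

lemma qpath_target_arrow: "qpath_target Q (u, [a]) = head Q a"
  by (simp add: qpath_target_def pre_digraph.awalk_verts.simps)

text \<open>An arrow factors only as itself preceded or followed by a trivial path, which gives a
  Leibniz rule.\<close>

lemma lookup_path_mult_arrow:
  "Poly_Mapping.lookup (path_mult Q f g) (tail Q a, [a]) =
    Poly_Mapping.lookup f (tail Q a, []) * Poly_Mapping.lookup g (tail Q a, [a]) +
    Poly_Mapping.lookup f (tail Q a, [a]) * Poly_Mapping.lookup g (head Q a, [])"
  by (subst lookup_path_mult[of "{((tail Q a, []), (tail Q a, [a])), ((tail Q a, [a]), (head Q a, []))}"])
    (auto simp: qpath_target_Nil qpath_target_arrow append_eq_Cons_conv)

lemma lookup_arrow_elem:
  "Poly_Mapping.lookup (arrow_elem Q a) x = (if x = (tail Q a, [a]) then 1 else 0)"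
  by (simp add: arrow_elem_def path_elem_def lookup_single when_def)

lemma path_mult_arrow_elem:
  assumes "head Q a = tail Q b"
  shows "path_mult Q (arrow_elem Q a) (arrow_elem Q b) = path_elem (tail Q a, [a, b])"
  using assms by (simp add: arrow_elem_def path_elem_def path_mult_single qpath_target_arrow)

text \<open>Independent of the representative only for trivial paths and arrows.\<close>

definition coset_coeff :: "('b \<Rightarrow>\<^sub>0 'k::zero) set \<Rightarrow> 'b \<Rightarrow> 'k" where
  "coset_coeff X z = Poly_Mapping.lookup (SOME x. x \<in> X) z"

text \<open>A locale, so that the results can also be instantiated at the quiver with arrows
  deleted.\<close>

locale bound_quiver_loc =
  fixes Q :: "('v, 'a) pre_digraph" and I :: "(('v, 'a) qpath \<Rightarrow>\<^sub>0 'k::field) set"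
  assumes bound_quiver: "bound_quiver Q I"
begin

abbreviation "\<Lambda> \<equiv> bound_quiver_algebra Q I"
abbreviation coset where "coset f \<equiv> I +>\<^bsub>path_algebra Q\<^esub> f"

sublocale fin_digraph Q
  using bound_quiver by (simp add: bound_quiver_def)

sublocale I: ideal I "path_algebra Q"
  using bound_quiver by (simp add: bound_quiver_def admissible_ideal_def)

sublocale \<Lambda>: ring \<Lambda>
  by (rule ring_bound_quiver_algebra[OF bound_quiver])

lemma lookup_ideal:
  assumes "f \<in> I" "length (snd z) < 2"
  shows "Poly_Mapping.lookup f z = 0"
  using bound_quiver assms
  by (force simp: bound_quiver_def admissible_ideal_def in_keys_iff)

text \<open>Two representatives differ by an element of \<open>I\<close>, which by admissibility
  involves only paths of length at least 2.\<close>

lemma coset_coeff_coset: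
  assumes "f \<in> carrier (path_algebra Q)" "length (snd z) < 2"
  shows "coset_coeff (coset f) z = Poly_Mapping.lookup f z"
proof -
  have "f \<in> coset f" using assms(1) by (rule I.a_rcos_self)
  then have "(SOME x. x \<in> coset f) \<in> coset f" by (rule someI)
  then obtain h where h: "h \<in> I" "(SOME x. x \<in> coset f) = h + f"
    by (auto simp: a_r_coset_def' path_algebra_def)
  then show ?thesis
    using lookup_ideal[OF h(1) assms(2)] by (simp add: coset_coeff_def lookup_add)
qed

section \<open>Arithmetic of cosets and their coefficients\<close>

lemma carrier_quotient: "X \<in> carrier \<Lambda> \<longleftrightarrow> (\<exists>f\<in>carrier (path_algebra Q). X = coset f)"
  by (auto simp: bound_quiver_algebra_def FactRing_def A_RCOSETS_def')

lemma coset_mult: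
  "\<lbrakk>f \<in> carrier (path_algebra Q); g \<in> carrier (path_algebra Q)\<rbrakk> \<Longrightarrow>
    coset f \<otimes>\<^bsub>\<Lambda>\<^esub> coset g = coset (path_mult Q f g)"
  using I.rcoset_mult_add[of f g]
  by (simp add: bound_quiver_algebra_def FactRing_def) (simp add: path_algebra_def)

lemma coset_add:
  "\<lbrakk>f \<in> carrier (path_algebra Q); g \<in> carrier (path_algebra Q)\<rbrakk> \<Longrightarrow>
    coset f \<oplus>\<^bsub>\<Lambda>\<^esub> coset g = coset (f + g)"
  using I.a_rcos_sum[of f g]
  by (simp add: bound_quiver_algebra_def FactRing_def) (simp add: path_algebra_def)

lemma coset_ideal: "f \<in> I \<Longrightarrow> coset f = \<zero>\<^bsub>\<Lambda>\<^esub>"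
  using I.a_rcos_const[of f] by (simp add: bound_quiver_algebra_def FactRing_def)

lemma path_mult_closed:
  fixes f g :: "('v, 'a) qpath \<Rightarrow>\<^sub>0 'k"
  shows "\<lbrakk>f \<in> carrier (path_algebra Q); g \<in> carrier (path_algebra Q)\<rbrakk> \<Longrightarrow>
    path_mult Q f g \<in> carrier (path_algebra Q)"
  using I.m_closed[of f g] by (simp add: path_algebra_def)

lemma add_closed:
  fixes f g :: "('v, 'a) qpath \<Rightarrow>\<^sub>0 'k"
  shows "\<lbrakk>f \<in> carrier (path_algebra Q); g \<in> carrier (path_algebra Q)\<rbrakk> \<Longrightarrow>
    f + g \<in> carrier (path_algebra Q)"
  using I.a_closed[of f g] by (simp add: path_algebra_def)

lemma arrow_elem_closed: "a \<in> arcs Q \<Longrightarrow> arrow_elem Q a \<in> carrier (path_algebra Q)"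
  by (auto simp: path_algebra_def arrow_elem_def path_elem_def qpaths_def awalk_def cas.simps)

lemma arrow_coset_closed: "a \<in> arcs Q \<Longrightarrow> coset (arrow_elem Q a) \<in> carrier \<Lambda>"
  using arrow_elem_closed carrier_quotient by blast

lemma coset_coeff_add:
  assumes "X \<in> carrier \<Lambda>" "Y \<in> carrier \<Lambda>" "length (snd z) < 2"
  shows "coset_coeff (X \<oplus>\<^bsub>\<Lambda>\<^esub> Y) z = coset_coeff X z + coset_coeff Y z"
  using assms
  by (auto simp: carrier_quotient coset_add coset_coeff_coset add_closed lookup_add)

lemma coset_coeff_mult_trivial:
  assumes "X \<in> carrier \<Lambda>" "Y \<in> carrier \<Lambda>"
  shows "coset_coeff (X \<otimes>\<^bsub>\<Lambda>\<^esub> Y) (v, []) = coset_coeff X (v, []) * coset_coeff Y (v, [])"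
  using assms
  by (auto simp: carrier_quotient coset_mult coset_coeff_coset path_mult_closed
      lookup_path_mult_trivial)

lemma coset_coeff_mult_arrow:
  assumes "X \<in> carrier \<Lambda>" "Y \<in> carrier \<Lambda>"
  shows "coset_coeff (X \<otimes>\<^bsub>\<Lambda>\<^esub> Y) (tail Q a, [a]) =
    coset_coeff X (tail Q a, []) * coset_coeff Y (tail Q a, [a]) +
    coset_coeff X (tail Q a, [a]) * coset_coeff Y (head Q a, [])"
  using assms
  by (auto simp: carrier_quotient coset_mult coset_coeff_coset path_mult_closed
      lookup_path_mult_arrow)

text \<open>Since \<open>l\<close> starts and ends at \<open>i\<close>, the Leibniz rule at
  \<open>l\<close> uses the same trivial coefficient on both sides, as the dual numbers
  require.\<close>

lemma dual_number_character_loop: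
  assumes "squared_zero_loop Q I l i"
  shows "dual_number_character \<Lambda> (\<lambda>X. coset_coeff X (i, [])) (\<lambda>X. coset_coeff X (i, [l]))
    (coset (arrow_elem Q l))"
proof -
  have l: "l \<in> arcs Q" "tail Q l = i" "head Q l = i"
    and sq: "path_mult Q (arrow_elem Q l) (arrow_elem Q l) \<in> I"
    using assms by (simp_all add: squared_zero_loop_def path_algebra_def)
  show ?thesis
  proof (intro dual_number_character.intro dual_number_character_axioms.intro \<Lambda>.ring_axioms)
    fix X Y assume "X \<in> carrier \<Lambda>" "Y \<in> carrier \<Lambda>"
    then show "coset_coeff (X \<otimes>\<^bsub>\<Lambda>\<^esub> Y) (i, [l]) =
        coset_coeff X (i, []) * coset_coeff Y (i, [l]) + coset_coeff X (i, [l]) * coset_coeff Y (i, [])"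
      using coset_coeff_mult_arrow[of X Y l] l by simp
  qed (use l sq in \<open>simp_all add: coset_coeff_add coset_coeff_mult_trivial arrow_coset_closed
      coset_mult arrow_elem_closed coset_ideal coset_coeff_coset lookup_arrow_elem\<close>)
qed

section \<open>Ideals generated by arrows\<close>

lemma ideal_arrow_ideal: "A \<subseteq> arcs Q \<Longrightarrow> ideal (arrow_ideal Q I A) \<Lambda>"
  unfolding arrow_ideal_def using arrow_coset_closed by (intro \<Lambda>.genideal_ideal) blast

lemma arrow_coset_in_arrow_ideal:
  assumes "A \<subseteq> arcs Q" "a \<in> A"
  shows "coset (arrow_elem Q a) \<in> arrow_ideal Q I A"
  using \<Lambda>.genideal_self[of "(\<lambda>a. coset (arrow_elem Q a)) ` A"] arrow_coset_closed assms
  unfolding arrow_ideal_def by blast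

text \<open>The coefficient at a trivial path is additive and multiplicative, so its kernel is an
  ideal; it contains every arrow.\<close>

lemma coset_coeff_arrow_ideal:
  assumes A: "A \<subseteq> arcs Q" and X: "X \<in> arrow_ideal Q I A"
  shows "coset_coeff X (v, []) = 0"
proof -
  let ?K = "{X \<in> carrier \<Lambda>. coset_coeff X (v, []) = 0}"
  have "ideal ?K \<Lambda>"
    by (rule \<Lambda>.kernel_ideal) (simp_all add: coset_coeff_add coset_coeff_mult_trivial)
  moreover have "(\<lambda>a. coset (arrow_elem Q a)) ` A \<subseteq> ?K"
    using A by (auto simp: arrow_coset_closed coset_coeff_coset arrow_elem_closed lookup_arrow_elem)
  ultimately have "arrow_ideal Q I A \<subseteq> ?K"
    unfolding arrow_ideal_def by (rule \<Lambda>.genideal_minimal)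
  then show ?thesis using X by blast
qed

theorem infinite_right_proj_dim_arrow_ideal:
  assumes loop: "squared_zero_loop Q I l i" and A: "A \<subseteq> arcs Q" "\<alpha> \<in> A" and \<alpha>: "head Q \<alpha> = i"
    and zero: "arrow_elem Q \<alpha> \<otimes>\<^bsub>path_algebra Q\<^esub> arrow_elem Q l \<in> I"
  shows "\<not> finite_right_proj_dim \<Lambda> (arrow_ideal Q I A)"
proof -
  let ?J = "arrow_ideal Q I A" and ?op = "opposite_ring \<Lambda>"
  let ?M = "ideal_module ?op ?J" and ?m = "coset (arrow_elem Q \<alpha>)"
  interpret D: dual_number_character ?op "\<lambda>X. coset_coeff X (i, [])" "\<lambda>X. coset_coeff X (i, [l])"
    "coset (arrow_elem Q l)"
    by (rule dual_number_character_opposite[OF dual_number_character_loop[OF loop]])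
  interpret J: ideal ?J \<Lambda> by (rule ideal_arrow_ideal[OF A(1)])
  have l: "l \<in> arcs Q" using loop by (simp add: squared_zero_loop_def)
  have zero': "path_mult Q (arrow_elem Q \<alpha>) (arrow_elem Q l) \<in> I"
    using zero by (simp add: path_algebra_def)
  have sel: "carrier ?op = carrier \<Lambda>" "carrier ?M = ?J" "zero ?M = \<zero>\<^bsub>\<Lambda>\<^esub>" "add ?M = add \<Lambda>"
    "smult ?M = (\<lambda>a b. b \<otimes>\<^bsub>\<Lambda>\<^esub> a)"
    by (simp_all add: ideal_module_def opposite_ring_def)
  have "lmodule ?op ?M"
    by (rule lmodule_ideal_module[OF ideal_opposite_ring[OF J.ideal_axioms]])
  moreover have "D.detected ?M (carrier ?M)"
    unfolding D.detected_def
  proof (intro exI conjI)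
    \<comment> \<open>Trivial coefficients vanish on the ideal, so for the right action only the
      Leibniz term with the trivial path at \<open>head Q \<alpha> = i\<close> survives.\<close>
    show "char_functional ?op (\<lambda>X. coset_coeff X (i, [])) ?M (carrier ?M)
        (\<lambda>X. coset_coeff X (tail Q \<alpha>, [\<alpha>]))"
      unfolding char_functional_def sel
      using coset_coeff_arrow_ideal[OF A(1)] J.Icarr
      by (simp add: coset_coeff_add coset_coeff_mult_arrow \<alpha> mult.commute)
    show "?m \<in> carrier ?M"
      unfolding sel by (rule arrow_coset_in_arrow_ideal[OF A])
    show "coset (arrow_elem Q l) \<odot>\<^bsub>?M\<^esub> ?m = \<zero>\<^bsub>?M\<^esub>"
      unfolding sel using l A zero' by (auto simp: coset_mult arrow_elem_closed coset_ideal)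
    show "coset_coeff ?m (tail Q \<alpha>, [\<alpha>]) \<noteq> 0"
      using A by (auto simp: coset_coeff_coset arrow_elem_closed lookup_arrow_elem)
  qed
  ultimately show ?thesis
    unfolding finite_right_proj_dim_def by (rule D.detected_infinite_proj_dim)
qed

end


section \<open>Deleting arrows\<close>

lemma delete_arrows_simps:
  "arcs (delete_arrows Q A) = arcs Q - A" "verts (delete_arrows Q A) = verts Q"
  "tail (delete_arrows Q A) = tail Q" "head (delete_arrows Q A) = head Q"
  by (simp_all add: delete_arrows_def)

lemma qpath_target_delete_arrows: "qpath_target (delete_arrows Q A) = qpath_target Q"
proof -
  have "qpath_target (delete_arrows Q A) (u, p) = qpath_target Q (u, p)" for u p
    by (simp add: qpath_target_def pre_digraph.awalk_verts_conv delete_arrows_simps)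
  then show ?thesis by (intro ext) auto
qed

lemma path_mult_delete_arrows: "path_mult (delete_arrows Q A) = path_mult Q"
  by (intro ext) (simp add: path_mult_def qpath_target_delete_arrows)

lemma arrow_elem_delete_arrows: "arrow_elem (delete_arrows Q A) = arrow_elem Q"
  by (intro ext) (simp add: arrow_elem_def delete_arrows_simps)

lemma qpaths_delete_arrows: "qpaths (delete_arrows Q A) = {x \<in> qpaths Q. avoids A x}"
proof -
  have cas: "pre_digraph.cas (delete_arrows Q A) u p v \<longleftrightarrow> pre_digraph.cas Q u p v" for u p v
    by (induction p arbitrary: u) (simp_all add: pre_digraph.cas.simps delete_arrows_simps)
  show ?thesis
    by (auto simp: qpaths_def avoids_def pre_digraph.awalk_def cas delete_arrows_simps)
qed

text \<open>Paths avoiding \<open>A\<close> span a subring with the same unit, since all vertices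
  remain. The new ideal is the intersection of \<open>I\<close> with it and inherits both length
  conditions.\<close>

lemma bound_quiver_delete_arrows:
  assumes "bound_quiver Q I"
  shows "bound_quiver (delete_arrows Q A) (avoiding_ideal I A)"
proof -
  interpret bound_quiver_loc Q I using assms by unfold_locales
  let ?Q = "delete_arrows Q A" and ?I = "avoiding_ideal I A"
  let ?R = "path_algebra ?Q :: (('a, 'b) qpath \<Rightarrow>\<^sub>0 'c) ring"
  have fin: "fin_digraph ?Q"
    by unfold_locales (auto simp: delete_arrows_simps)
  interpret R: ring ?R by (rule ring_path_algebra[OF fin])
  have carr: "carrier ?R = {f \<in> carrier (path_algebra Q). \<forall>x\<in>Poly_Mapping.keys f. avoids A x}"
    by (auto simp: path_algebra_def qpaths_delete_arrows)
  have mult_eq: "mult ?R = path_mult Q"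
    by (simp add: path_algebra_def path_mult_delete_arrows)
  have sub: "?I \<subseteq> carrier ?R"
    using I.Icarr by (auto simp: carr avoiding_ideal_def)
  have mult: "path_mult Q f g \<in> ?I"
    if "f \<in> carrier ?R" "g \<in> carrier ?R" "f \<in> I \<or> g \<in> I" for f g
  proof -
    have "path_mult Q f g \<in> carrier ?R"
      using R.m_closed[OF that(1,2)] by (simp add: path_algebra_def path_mult_delete_arrows)
    moreover have "path_mult Q f g \<in> I"
      using that I.I_l_closed[of g f] I.I_r_closed[of f g]
      by (auto simp: carr) (auto simp: path_algebra_def)
    ultimately show ?thesis by (simp add: carr avoiding_ideal_def)
  qed
  have add: "f + g \<in> ?I" if "f \<in> ?I" "g \<in> ?I" for f g
  proof -
    have "f + g \<in> carrier ?R"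
      using R.a_closed[of f g] that sub by (auto simp: path_algebra_def)
    moreover have "f + g \<in> I"
      using additive_subgroup.a_closed[OF I.is_additive_subgroup, of f g] that
      by (simp add: avoiding_ideal_def path_algebra_def)
    ultimately show ?thesis by (simp add: carr avoiding_ideal_def)
  qed
  have "ideal ?I ?R"
  proof (rule R.ring_axioms[THEN idealI])
    show "subgroup ?I (add_monoid ?R)"
    proof (rule R.add.subgroupI)
      show "?I \<noteq> {}"
        using additive_subgroup.zero_closed[OF I.is_additive_subgroup]
        by (auto simp: avoiding_ideal_def path_algebra_def)
      fix f assume f: "f \<in> ?I"
      \<comment> \<open>Writing the negative as a multiple by minus one reduces closure under
        negation to \<open>mult\<close>.\<close>
      have "\<ominus>\<^bsub>?R\<^esub> f = \<ominus>\<^bsub>?R\<^esub> \<one>\<^bsub>?R\<^esub> \<otimes>\<^bsub>?R\<^esub> f"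
        using f sub R.l_minus[of "\<one>\<^bsub>?R\<^esub>" f] by auto
      also have "\<dots> = path_mult Q (\<ominus>\<^bsub>?R\<^esub> \<one>\<^bsub>?R\<^esub>) f"
        by (simp only: mult_eq)
      also have "\<dots> \<in> ?I"
      proof (rule mult)
        show "f \<in> carrier ?R" using f sub by blast
        show "\<ominus>\<^bsub>?R\<^esub> \<one>\<^bsub>?R\<^esub> \<in> I \<or> f \<in> I" using f by (simp add: avoiding_ideal_def)
      qed simp
      finally show "\<ominus>\<^bsub>?R\<^esub> f \<in> ?I" .
    qed (use sub add in \<open>auto simp: path_algebra_def\<close>)
  next
    fix f g assume "f \<in> ?I" "g \<in> carrier ?R"
    with mult sub show "g \<otimes>\<^bsub>?R\<^esub> f \<in> ?I" "f \<otimes>\<^bsub>?R\<^esub> g \<in> ?I"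
      by (auto simp: path_algebra_def path_mult_delete_arrows avoiding_ideal_def)
  qed
  then show ?thesis
    using bound_quiver fin
    by (fastforce simp: bound_quiver_def admissible_ideal_def avoiding_ideal_def
        qpaths_delete_arrows path_elem_def)
qed

text \<open>While \<open>l\<close> is still present, both the loop relation and the relation for
  \<open>\<alpha>\<close> avoid \<open>A\<close> and persist in the quotient.\<close>

lemma not_removable_in_quotient:
  assumes bq: "bound_quiver Q I" and loop: "squared_zero_loop Q I l i" and "l \<notin> A"
    and "\<alpha> \<in> B" "head Q \<alpha> = i"
    and zero: "arrow_elem Q \<alpha> \<otimes>\<^bsub>path_algebra Q\<^esub> arrow_elem Q l \<in> I"
  shows "\<not> removable_in_quotient Q I A B"
proof
  assume rem: "removable_in_quotient Q I A B"
  then have B: "B \<subseteq> arcs Q - A" by (simp add: removable_in_quotient_def)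
  interpret bound_quiver_loc "delete_arrows Q A" "avoiding_ideal I A"
    using bound_quiver_delete_arrows[OF bq] by unfold_locales
  \<comment> \<open>Stated for a general \<open>\<beta>\<close> because it serves for
    \<open>l\<close> as well as for \<open>\<alpha>\<close>.\<close>
  have "arrow_elem Q \<beta> \<otimes>\<^bsub>path_algebra (delete_arrows Q A)\<^esub> arrow_elem Q l \<in> avoiding_ideal I A"
    if "\<beta> \<notin> A" "head Q \<beta> = i"
      and "arrow_elem Q \<beta> \<otimes>\<^bsub>path_algebra Q\<^esub> arrow_elem Q l \<in> I" for \<beta>
    using that loop \<open>l \<notin> A\<close>
    by (simp add: path_algebra_def path_mult_delete_arrows path_mult_arrow_elem avoiding_ideal_def
        squared_zero_loop_def) (simp add: path_elem_def avoids_def)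
  then have "squared_zero_loop (delete_arrows Q A) (avoiding_ideal I A) l i"
    and "arrow_elem Q \<alpha> \<otimes>\<^bsub>path_algebra (delete_arrows Q A)\<^esub> arrow_elem Q l \<in> avoiding_ideal I A"
    using assms B by (auto simp: squared_zero_loop_def arrow_elem_delete_arrows delete_arrows_simps)
  then have "\<not> finite_right_proj_dim (bound_quiver_algebra (delete_arrows Q A) (avoiding_ideal I A))
      (arrow_ideal (delete_arrows Q A) (avoiding_ideal I A) B)"
    using infinite_right_proj_dim_arrow_ideal[of l i B \<alpha>] assms B
    by (simp add: arrow_elem_delete_arrows delete_arrows_simps)
  then show False
    using rem by (auto simp: removable_in_quotient_def removable_def
        two_sided_removable_def only_left_removable_def)
qed

lemma not_eventually_removable:
  assumes bq: "bound_quiver Q I" and loop: "squared_zero_loop Q I l i" and "head Q \<alpha> = i"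
    and zero: "arrow_elem Q \<alpha> \<otimes>\<^bsub>path_algebra Q\<^esub> arrow_elem Q l \<in> I"
  shows "\<not> eventually_removable_arrow Q I \<alpha>"
proof
  assume "eventually_removable_arrow Q I \<alpha>"
  then obtain As where "\<alpha> \<in> \<Union>(set As)"
    and As: "\<And>r. r < length As \<Longrightarrow> removable_in_quotient Q I (\<Union>(set (take r As))) (As ! r)"
    unfolding eventually_removable_arrow_def maximal_eventually_removable_set_def
      eventually_removable_set_def by blast
  then obtain r where r: "r < length As" "\<alpha> \<in> As ! r"
    by (auto simp: in_set_conv_nth)
  \<comment> \<open>Removing the block of \<open>\<alpha>\<close> is possible only if
    \<open>l\<close> has gone in a strictly earlier block.\<close>
  with not_removable_in_quotient[OF bq loop _ r(2) assms(3,4)] As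
  have "l \<in> \<Union>(set (take r As))" by blast
  then obtain s where s: "s < length As" "l \<in> As ! s"
    by (auto simp: in_set_conv_nth)
  \<comment> \<open>Blocks avoid their predecessors, so \<open>l\<close> is present when its own
    block is removed; the same obstruction now applies with \<open>l\<close> as
    \<open>\<alpha>\<close>.\<close>
  have "l \<notin> \<Union>(set (take s As))"
    using As[OF s(1)] s(2) by (auto simp: removable_in_quotient_def)
  with not_removable_in_quotient[OF bq loop _ s(2)] loop As[OF s(1)] show False
    by (simp add: squared_zero_loop_def)
qed

theorem corollary4p13:
  fixes Q :: "('v, 'a) pre_digraph"
    and I :: "(('v, 'a) qpath \<Rightarrow>\<^sub>0 'k::field) set"
    and l :: 'a and i :: 'v
  assumes "bound_quiver Q I"
    and "squared_zero_loop Q I l i"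
  shows "(\<forall>\<alpha>\<in>arcs Q.
            head Q \<alpha> = i \<and>
            arrow_elem Q \<alpha> \<otimes>\<^bsub>path_algebra Q\<^esub> arrow_elem Q l \<in> I \<longrightarrow>
            \<not> eventually_removable_arrow Q I \<alpha>) \<and>
         \<not> eventually_removable_arrow Q I l"
proof -
  have "head Q l = i" "arrow_elem Q l \<otimes>\<^bsub>path_algebra Q\<^esub> arrow_elem Q l \<in> I"
    using assms(2) by (simp_all add: squared_zero_loop_def)
  then show ?thesis using not_eventually_removable[OF assms] by blast
qed

end
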